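(* Let $C$ be a convex subset of a real vector space, $x_1,\dots,x_n\in C$, and $\varphi:C\to\mathbb{R}$ a convex function. Let $\mu=(\mu_1,\dots,\mu_m)$ and $\lambda=(\lambda_1,\dots,\lambda_n)$ be probability vectors, and let $\omega$ be a weight function with respect to $\mu$ and $\lambda$. Then $$\varphi\left(\sum_{j=1}^n\lambda_jx_j\right)\le\sum_{i=1}^m\mu_i\,\varphi\left(\sum_{j=1}^n\omega(i,j)\lambda_jx_j\right)\le\sum_{j=1}^n\lambda_j\varphi(x_j).$$ In particular, if $[a_{ij}]_{n\times n}$ is a double stochastic matrix, then $$\varphi\left(\frac{x_1+\cdots+x_n}{n}\right)\le\frac1n\sum_{i=1}^n\varphi\left(\sum_{j=1}^na_{ij}x_j\right)\le\frac{\varphi(x_1)+\cdots+\varphi(x_n)}{n}.$$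
   Context: $m,n\ge1$ are integers. Probability vectors: $\mu_i\ge0$, $\lambda_j\ge0$, $\sum_{i=1}^m\mu_i=1$, $\sum_{j=1}^n\lambda_j=1$. A weight function with respect to $\mu$ and $\lambda$ is a map $\omega:\{1,\dots,m\}\times\{1,\dots,n\}\to[0,\infty)$ such that $\sum_{i=1}^m\omega(i,j)\mu_i=1$ for every $j=1,\dots,n$ and $\sum_{j=1}^n\omega(i,j)\lambda_j=1$ for every $i=1,\dots,m$. A double stochastic matrix is a square matrix with nonnegative real entries each of whose rows and columns sums to $1$. *)

theory Defs
  imports "HOL-Analysis.Analysis"
begin

(* Vectors of length n and m x n matrices are functions on nat; only their values at
   the indices 1, ..., n (resp. 1, ..., m and 1, ..., n) are meaningful. *)

definition prob_vector :: "nat \<Rightarrow> (nat \<Rightarrow> real) \<Rightarrow> bool" where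
  "prob_vector n p \<longleftrightarrow> (\<forall>i\<in>{1..n}. 0 \<le> p i) \<and> (\<Sum>i=1..n. p i) = 1"

definition weight_function ::
  "nat \<Rightarrow> nat \<Rightarrow> (nat \<Rightarrow> real) \<Rightarrow> (nat \<Rightarrow> real) \<Rightarrow> (nat \<Rightarrow> nat \<Rightarrow> real) \<Rightarrow> bool" where
  "weight_function m n \<mu> \<Lambda> \<omega> \<longleftrightarrow>
     (\<forall>i\<in>{1..m}. \<forall>j\<in>{1..n}. 0 \<le> \<omega> i j) \<and>
     (\<forall>j\<in>{1..n}. (\<Sum>i=1..m. \<omega> i j * \<mu> i) = 1) \<and>
     (\<forall>i\<in>{1..m}. (\<Sum>j=1..n. \<omega> i j * \<Lambda> j) = 1)"

definition double_stochastic :: "nat \<Rightarrow> (nat \<Rightarrow> nat \<Rightarrow> real) \<Rightarrow> bool" where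
  "double_stochastic n a \<longleftrightarrow>
     (\<forall>i\<in>{1..n}. \<forall>j\<in>{1..n}. 0 \<le> a i j) \<and>
     (\<forall>i\<in>{1..n}. (\<Sum>j=1..n. a i j) = 1) \<and>
     (\<forall>j\<in>{1..n}. (\<Sum>i=1..n. a i j) = 1)"

end

theory Submission
  imports Defs
begin

text \<open>
  The numbers \<open>\<mu>\<^sub>i \<omega>(i,j) \<Lambda>\<^sub>j\<close> are a joint distribution of \<open>(i,j)\<close> with marginals \<open>\<mu>\<close> and \<open>\<Lambda>\<close>, and both
  inequalities are Jensen's inequality: one for the conditional means of \<open>x\<^sub>j\<close> given \<open>i\<close>, one for
  the conditional distributions themselves.

  Put \<open>y\<^sub>i = \<Sum>\<^sub>j \<omega>(i,j) \<Lambda>\<^sub>j x\<^sub>j\<close>. The row condition on \<open>\<omega>\<close> makes each \<open>y\<^sub>i\<close> a convex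
  combination of the points \<open>x\<^sub>j\<close>, so \<open>y\<^sub>i \<in> C\<close>; the column condition says that averaging the \<open>y\<^sub>i\<close>
  with weights \<open>\<mu>\<^sub>i\<close> gives back \<open>\<Sum>\<^sub>j \<Lambda>\<^sub>j x\<^sub>j\<close>. Jensen over \<open>i\<close> is therefore the left inequality. For
  the right one, apply Jensen over \<open>j\<close> to every \<open>\<phi> y\<^sub>i\<close>, average over \<open>i\<close>, and use the column
  condition once more, now on the values \<open>\<phi> x\<^sub>j\<close> in place of the points \<open>x\<^sub>j\<close>.

  A double stochastic matrix \<open>a\<close> gives the weight function \<open>n a\<^sub>i\<^sub>j\<close> for the two uniform vectors
  \<open>(1/n, \<dots>, 1/n)\<close>, so the second statement is the case \<open>m = n\<close> of the first.
\<close>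

text \<open>
  The column condition as an exchange of summation. It is needed for vectors (to recover the
  barycentre) and for real numbers (to recover the mean of the values), hence the general type.
\<close>

lemma weight_function_average_columns:
  fixes z :: "nat \<Rightarrow> 'b::real_vector"
  assumes "weight_function m n \<mu> \<Lambda> \<omega>"
  shows "(\<Sum>i=1..m. \<mu> i *\<^sub>R (\<Sum>j=1..n. (\<omega> i j * \<Lambda> j) *\<^sub>R z j)) = (\<Sum>j=1..n. \<Lambda> j *\<^sub>R z j)"
proof -
  have "(\<Sum>i=1..m. \<mu> i *\<^sub>R (\<Sum>j=1..n. (\<omega> i j * \<Lambda> j) *\<^sub>R z j))
      = (\<Sum>i=1..m. \<Sum>j=1..n. (\<omega> i j * \<mu> i) *\<^sub>R \<Lambda> j *\<^sub>R z j)"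
    by (simp add: scaleR_sum_right mult_ac)
  also have "\<dots> = (\<Sum>j=1..n. (\<Sum>i=1..m. \<omega> i j * \<mu> i) *\<^sub>R \<Lambda> j *\<^sub>R z j)"
    by (subst sum.swap) (simp only: scaleR_sum_left)
  also have "\<dots> = (\<Sum>j=1..n. \<Lambda> j *\<^sub>R z j)"
    using assms by (intro sum.cong) (simp_all add: weight_function_def)
  finally show ?thesis .
qed

lemma prob_vector_index_nonempty:
  assumes "prob_vector n p"
  shows "{1..n} \<noteq> {}"
  using assms by (cases n) (auto simp: prob_vector_def)

lemma prob_vector_weight_function_row:
  assumes "weight_function m n \<mu> \<Lambda> \<omega>" "prob_vector n \<Lambda>" "i \<in> {1..m}"
  shows "prob_vector n (\<lambda>j. \<omega> i j * \<Lambda> j)"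
  using assms by (auto simp: prob_vector_def weight_function_def)

lemma jensen_prob_vector:
  fixes x :: "nat \<Rightarrow> 'a::real_vector"
  assumes "convex_on C \<phi>" "prob_vector n p" "\<And>j. j \<in> {1..n} \<Longrightarrow> x j \<in> C"
  shows "\<phi> (\<Sum>j=1..n. p j *\<^sub>R x j) \<le> (\<Sum>j=1..n. p j * \<phi> (x j))"
  using assms prob_vector_index_nonempty[OF assms(2)]
  by (intro convex_on_sum[of _ C]) (auto simp: prob_vector_def)

lemma jensen_weight_function:
  fixes x :: "nat \<Rightarrow> 'a::real_vector"
  assumes \<phi>: "convex_on C \<phi>" and x: "\<And>j. j \<in> {1..n} \<Longrightarrow> x j \<in> C"
    and \<mu>: "prob_vector m \<mu>" and \<Lambda>: "prob_vector n \<Lambda>"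
    and \<omega>: "weight_function m n \<mu> \<Lambda> \<omega>"
  shows "\<phi> (\<Sum>j=1..n. \<Lambda> j *\<^sub>R x j)
           \<le> (\<Sum>i=1..m. \<mu> i * \<phi> (\<Sum>j=1..n. (\<omega> i j * \<Lambda> j) *\<^sub>R x j))" (is "?L \<le> ?M")
    and "(\<Sum>i=1..m. \<mu> i * \<phi> (\<Sum>j=1..n. (\<omega> i j * \<Lambda> j) *\<^sub>R x j))
           \<le> (\<Sum>j=1..n. \<Lambda> j * \<phi> (x j))" (is "_ \<le> ?R")
proof -
  define y where "y i = (\<Sum>j=1..n. (\<omega> i j * \<Lambda> j) *\<^sub>R x j)" for i
  note row = prob_vector_weight_function_row[OF \<omega> \<Lambda>]
  have y: "y i \<in> C" if "i \<in> {1..m}" for i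
    unfolding y_def using row[OF that] convex_on_imp_convex[OF \<phi>] x
    by (intro convex_sum) (auto simp: prob_vector_def)
  have "?L = \<phi> (\<Sum>i=1..m. \<mu> i *\<^sub>R y i)"
    by (simp only: y_def weight_function_average_columns[OF \<omega>])
  also have "\<dots> \<le> (\<Sum>i=1..m. \<mu> i * \<phi> (y i))"
    by (rule jensen_prob_vector[OF \<phi> \<mu> y])
  finally show "?L \<le> ?M"
    by (simp only: y_def)
  have "?M \<le> (\<Sum>i=1..m. \<mu> i * (\<Sum>j=1..n. (\<omega> i j * \<Lambda> j) * \<phi> (x j)))"
    using \<mu> by (intro sum_mono mult_left_mono jensen_prob_vector[OF \<phi> row x])
      (auto simp: prob_vector_def)
  also have "\<dots> = ?R"
    using weight_function_average_columns[OF \<omega>, of "\<lambda>j. \<phi> (x j)"] by simp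
  finally show "?M \<le> ?R" .
qed

lemma prob_vector_uniform:
  assumes "n \<ge> 1"
  shows "prob_vector n (\<lambda>_. 1 / real n)"
  using assms by (simp add: prob_vector_def)

text \<open>
  The factor \<open>n\<close> cancels the uniform weight \<open>1/n\<close>, which turns the two conditions on a weight
  function into the conditions that columns and rows sum to \<open>1\<close>.
\<close>

lemma weight_function_double_stochastic:
  assumes "n \<ge> 1" "double_stochastic n a"
  shows "weight_function n n (\<lambda>_. 1 / real n) (\<lambda>_. 1 / real n) (\<lambda>i j. real n * a i j)"
  using assms by (simp add: weight_function_def double_stochastic_def)

theorem lemma2p1:
  fixes C :: "'a::real_vector set" and \<phi> :: "'a \<Rightarrow> real"
    and x :: "nat \<Rightarrow> 'a" and n :: nat
  assumes "n \<ge> 1"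
    and "convex C"
    and "\<forall>j\<in>{1..n}. x j \<in> C"
    and "convex_on C \<phi>"
  shows "(\<forall>(m::nat) (\<mu> :: nat \<Rightarrow> real) (\<Lambda> :: nat \<Rightarrow> real) (\<omega> :: nat \<Rightarrow> nat \<Rightarrow> real).
            m \<ge> 1 \<and> prob_vector m \<mu> \<and> prob_vector n \<Lambda> \<and> weight_function m n \<mu> \<Lambda> \<omega> \<longrightarrow>
              \<phi> (\<Sum>j=1..n. \<Lambda> j *\<^sub>R x j)
                \<le> (\<Sum>i=1..m. \<mu> i * \<phi> (\<Sum>j=1..n. (\<omega> i j * \<Lambda> j) *\<^sub>R x j)) \<and>
              (\<Sum>i=1..m. \<mu> i * \<phi> (\<Sum>j=1..n. (\<omega> i j * \<Lambda> j) *\<^sub>R x j))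
                \<le> (\<Sum>j=1..n. \<Lambda> j * \<phi> (x j)))
       \<and> (\<forall>a :: nat \<Rightarrow> nat \<Rightarrow> real. double_stochastic n a \<longrightarrow>
              \<phi> ((1 / real n) *\<^sub>R (\<Sum>j=1..n. x j))
                \<le> (1 / real n) * (\<Sum>i=1..n. \<phi> (\<Sum>j=1..n. a i j *\<^sub>R x j)) \<and>
              (1 / real n) * (\<Sum>i=1..n. \<phi> (\<Sum>j=1..n. a i j *\<^sub>R x j))
                \<le> (\<Sum>j=1..n. \<phi> (x j)) / real n)"
proof (intro conjI allI impI; (elim conjE)?)
  fix m :: nat and \<mu> \<Lambda> :: "nat \<Rightarrow> real" and \<omega> :: "nat \<Rightarrow> nat \<Rightarrow> real"
  assume "prob_vector m \<mu>" "prob_vector n \<Lambda>" "weight_function m n \<mu> \<Lambda> \<omega>"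
  note J = jensen_weight_function[OF assms(4) bspec[OF assms(3)] this]
  show "\<phi> (\<Sum>j=1..n. \<Lambda> j *\<^sub>R x j)
          \<le> (\<Sum>i=1..m. \<mu> i * \<phi> (\<Sum>j=1..n. (\<omega> i j * \<Lambda> j) *\<^sub>R x j))"
    by (rule J(1))
  show "(\<Sum>i=1..m. \<mu> i * \<phi> (\<Sum>j=1..n. (\<omega> i j * \<Lambda> j) *\<^sub>R x j))
          \<le> (\<Sum>j=1..n. \<Lambda> j * \<phi> (x j))"
    by (rule J(2))
next
  fix a :: "nat \<Rightarrow> nat \<Rightarrow> real"
  assume a: "double_stochastic n a"
  note u = prob_vector_uniform[OF assms(1)]
  note J = jensen_weight_function[OF assms(4) bspec[OF assms(3)] u u
      weight_function_double_stochastic[OF assms(1) a]]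
  have cancel: "real n * a i j * (1 / real n) = a i j" for i j
    using assms(1) by simp
  show "\<phi> ((1 / real n) *\<^sub>R (\<Sum>j=1..n. x j))
          \<le> (1 / real n) * (\<Sum>i=1..n. \<phi> (\<Sum>j=1..n. a i j *\<^sub>R x j))"
    using J(1) unfolding cancel by (simp only: scaleR_sum_right sum_distrib_left)
  show "(1 / real n) * (\<Sum>i=1..n. \<phi> (\<Sum>j=1..n. a i j *\<^sub>R x j))
          \<le> (\<Sum>j=1..n. \<phi> (x j)) / real n"
    using J(2) unfolding cancel by (simp add: sum_distrib_left sum_divide_distrib)
qed

end
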